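(* For every signed group $S$, there exists no signed group orthogonal design $SOD(6;\,3,3,S)$ and no signed group orthogonal design $SOD(6;\,2,2,2,S)$.
   Context: A signed group is a group $S$ together with a distinguished central element of order two, denoted $-1$ (the unit is denoted $1$). Let $\varrho$ be a transversal of $\langle -1\rangle$ in $S$. The signed group ring $\mathbb{R}[S]$ consists of formal sums $\sum_i s_i r_i$ with $s_i\in\varrho$, $r_i\in\mathbb{R}$, where one identifies $(-s)r=s(-r)$ for $s\in\varrho$; addition is termwise and multiplication is by linear extension. Conjugation is $\overline{\sum_i s_i r_i}=\sum_i s_i^{-1} r_i$. A signed group orthogonal design of order $n$ and type $(u_1,\dots,u_k)$ over $S$, denoted $SOD(n;\,u_1,\dots,u_k,S)$, is an $n\times n$ matrix $X$ each of whose entries is either $0$ or of the form $\epsilon x_i$ with $\epsilon\in S$ and $x_1,\dots,x_k$ commuting (real) variables (a given variable may appear with different elements of $S$ as coefficients), such that $XX^*=\big(\sum_{i=1}^k u_i x_i^2\big)I_n$, where $u_1,\dots,u_k$ are positive integers, $X^*$ is the conjugate transpose (the conjugate of $\epsilon x_i$ being $\epsilon^{-1}x_i$), and all matrix operations are carried out over $\mathbb{R}[S]$ with the variables commuting with everything. *)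

theory Defs
  imports "HOL-Algebra.Algebra" "HOL-Library.Poly_Mapping"
begin

locale signed_group = group S for S (structure) +
  fixes z  \<comment> \<open>the distinguished element written $-1$\<close>
  assumes z_closed: "z \<in> carrier S"
    and z_ord: "ord z = 2"
    and z_central: "\<And>s. s \<in> carrier S \<Longrightarrow> z \<otimes> s = s \<otimes> z"

definition transversal :: "('a, 'b) monoid_scheme \<Rightarrow> 'a set \<Rightarrow> 'a set \<Rightarrow> bool" where
  "transversal G H T \<longleftrightarrow> T \<subseteq> carrier G \<and> (\<forall>C \<in> rcosets\<^bsub>G\<^esub> H. \<exists>!t. t \<in> T \<inter> C)"

text \<open>
  Over a transversal \<open>T\<close> of \<open>\<langle>-1\<rangle>\<close>, a formal sum is the family of its coefficients: a finitely
  supported function vanishing off \<open>T\<close>.  For an arbitrary group element \<open>s\<close>, the term \<open>s r\<close> is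
  normalised by \<open>(-t) r = t (-r)\<close>, so that it sits at whichever of \<open>s\<close>, \<open>-s\<close> lies in \<open>T\<close>.
\<close>

definition sg_term ::
  "('a, 'b) monoid_scheme \<Rightarrow> 'a \<Rightarrow> 'a set \<Rightarrow> 'a \<Rightarrow> 'r::comm_ring_1 \<Rightarrow> ('a \<Rightarrow> 'r)" where
  "sg_term S z T s r = (\<lambda>t. if t \<in> T then (if t = s then r else if t = z \<otimes>\<^bsub>S\<^esub> s then - r else 0) else 0)"

text \<open>
  The coefficients range over any commutative ring.  With real coefficients this is
  \<open>\<real>[S]\<close>; with coefficients in \<open>\<real>[x\<^sub>0, x\<^sub>1, \<dots>]\<close> it is \<open>\<real>[S]\<close> with variables adjoined that
  commute with each other and with everything else.
\<close>

definition signed_group_ring ::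
  "('a, 'b) monoid_scheme \<Rightarrow> 'a \<Rightarrow> 'a set \<Rightarrow> ('a \<Rightarrow> 'r::comm_ring_1) ring" where
  "signed_group_ring S z T =
    \<lparr>carrier = {f. finite {s. f s \<noteq> 0} \<and> {s. f s \<noteq> 0} \<subseteq> T},
     monoid.mult = (\<lambda>f g t. \<Sum>a | f a \<noteq> 0. \<Sum>b | g b \<noteq> 0. sg_term S z T (a \<otimes>\<^bsub>S\<^esub> b) (f a * g b) t),
     one = sg_term S z T \<one>\<^bsub>S\<^esub> 1,
     ring.zero = (\<lambda>t. 0),
     add = (\<lambda>f g t. f t + g t)\<rparr>"

definition sg_conj ::
  "('a, 'b) monoid_scheme \<Rightarrow> 'a \<Rightarrow> 'a set \<Rightarrow> ('a \<Rightarrow> 'r::comm_ring_1) \<Rightarrow> ('a \<Rightarrow> 'r)" where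
  "sg_conj S z T f = (\<lambda>t. \<Sum>a | f a \<noteq> 0. sg_term S z T (inv\<^bsub>S\<^esub> a) (f a) t)"

type_synonym rpoly = "(nat \<Rightarrow>\<^sub>0 nat) \<Rightarrow>\<^sub>0 real"

definition Var :: "nat \<Rightarrow> rpoly" where
  "Var i = Poly_Mapping.single (Poly_Mapping.single i 1) 1"

text \<open>
  An \<open>n \<times> n\<close> matrix is a function of two indices, of which only the values at indices below \<open>n\<close>
  matter.  The list \<open>us\<close> is the type \<open>(u\<^sub>1, \<dots>, u\<^sub>k)\<close>; its entry \<open>us ! v\<close> belongs to \<open>Var v\<close>.
\<close>

definition mat_mult ::
  "('c, 'd) ring_scheme \<Rightarrow> nat \<Rightarrow> (nat \<Rightarrow> nat \<Rightarrow> 'c) \<Rightarrow> (nat \<Rightarrow> nat \<Rightarrow> 'c) \<Rightarrow> (nat \<Rightarrow> nat \<Rightarrow> 'c)" where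
  "mat_mult R n A B = (\<lambda>i j. \<Oplus>\<^bsub>R\<^esub>l\<in>{..<n}. A i l \<otimes>\<^bsub>R\<^esub> B l j)"

definition conj_transpose ::
  "('a, 'b) monoid_scheme \<Rightarrow> 'a \<Rightarrow> 'a set \<Rightarrow> (nat \<Rightarrow> nat \<Rightarrow> ('a \<Rightarrow> 'r::comm_ring_1)) \<Rightarrow> (nat \<Rightarrow> nat \<Rightarrow> ('a \<Rightarrow> 'r))" where
  "conj_transpose S z T A = (\<lambda>i j. sg_conj S z T (A j i))"

definition is_SOD ::
  "('a, 'b) monoid_scheme \<Rightarrow> 'a \<Rightarrow> 'a set \<Rightarrow> nat \<Rightarrow> nat list \<Rightarrow> (nat \<Rightarrow> nat \<Rightarrow> ('a \<Rightarrow> rpoly)) \<Rightarrow> bool" where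
  "is_SOD S z T n us A \<longleftrightarrow>
    (\<forall>u\<in>set us. 0 < u) \<and>
    (\<forall>i<n. \<forall>j<n. A i j = \<zero>\<^bsub>signed_group_ring S z T\<^esub> \<or>
       (\<exists>s\<in>carrier S. \<exists>v<length us. A i j = sg_term S z T s (Var v))) \<and>
    (\<forall>i<n. \<forall>j<n. mat_mult (signed_group_ring S z T) n A (conj_transpose S z T A) i j =
       (if i = j then sg_term S z T \<one>\<^bsub>S\<^esub> (\<Sum>v<length us. of_nat (us ! v) * Var v ^ 2)
        else \<zero>\<^bsub>signed_group_ring S z T\<^esub>))"

end

theory Submission
  imports Defs
begin

text \<open>
  Counting variables on the diagonal of \<open>X X\<^sup>*\<close> shows that \<open>X\<close> has no zero entry, so each row colours
  the six columns with the variables.  For two distinct rows, the columns contributing a given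
  monomial cancel in pairs; in particular their number is even, and if there are just two of them,
  then the quotients of the two group elements in the two rows are opposite.

  In type \<open>(3, 3)\<close> the columns of the first variable give six triples in a six-element set that meet
  pairwise in an even number of points.  A disjoint pair would force every other triple to be even,
  so all intersections have size two; such a family lies in a 4-set or has a common pair, and
  either way has at most four members.

  In type \<open>(2, 2, 2)\<close> the parity conditions leave two relations between rows: they split the columns
  into the same three pairs (aligned), or each ordered pair of distinct colours occurs in
  exactly one column (mixed).  If all rows are aligned, then three of them differ by even permutations of
  the colours, and their quotients on a common pair of columns would be pairwise opposite.  If rows
  \<open>i\<close> and \<open>j\<close> are mixed, every row is coloured like \<open>i\<close>, like \<open>j\<close>, or by the third colour, and
  each of these colourings occurs exactly twice.  The two rows coloured like \<open>i\<close> have opposite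
  quotients on a pair of equally coloured columns, but comparison with \<open>j\<close> and a row of the third
  kind along a path between these columns shows that the quotients are equal.
\<close>

section \<open>Terms of the signed group ring\<close>

text \<open>A monomial of degree two is determined by its unordered pair of indices. Extracting a
  coefficient from a row product therefore selects the columns in which the two rows carry a given
  pair of variables.\<close>

lemma lookup_Var_mult:
  "Poly_Mapping.lookup (Var v * Var w) (Poly_Mapping.single a 1 + Poly_Mapping.single b 1) =
     (if {v, w} = {a, b} then 1 else 0)"
proof -
  have "(Poly_Mapping.single v 1 + Poly_Mapping.single w 1 =
      (Poly_Mapping.single a 1 + Poly_Mapping.single b 1 :: nat \<Rightarrow>\<^sub>0 nat)) \<longleftrightarrow> {v, w} = {a, b}"
    (is "?l = ?r \<longleftrightarrow> _")
  proof
    assume eq: "?l = ?r"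
    have "Poly_Mapping.lookup ?l k = Poly_Mapping.lookup ?r k" for k using eq by simp
    then have k: "(1 when v = k) + (1 when w = k) = ((1 when a = k) + (1 when b = k) :: nat)" for k
      by (simp add: lookup_add lookup_single)
    show "{v, w} = {a, b}"
      using k[of v] k[of w] k[of a] k[of b] by (auto simp: when_def split: if_splits)
  next
    assume "{v, w} = {a, b}"
    then show "?l = ?r" by (auto simp: doubleton_eq_iff add.commute)
  qed
  then show ?thesis
    by (simp add: Var_def mult_single lookup_single when_def del: insert_iff)
qed

lemma Var_eq_iff: "Var v = Var w \<longleftrightarrow> v = w"
  by (auto simp: Var_def dest!: arg_cong[where f = Poly_Mapping.keys])

lemma lookup_Var_or_zero_square:
  assumes "p = 0 \<or> (\<exists>w. p = Var w)"
  shows "Poly_Mapping.lookup (p * p) (Poly_Mapping.single v 1 + Poly_Mapping.single v 1) =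
    (if p = Var v then 1 else 0)"
proof -
  have "Var v \<noteq> 0" by (auto simp: Var_def dest!: arg_cong[where f = Poly_Mapping.keys])
  then show ?thesis using assms lookup_Var_mult[of _ _ v v] by (auto simp: Var_eq_iff)
qed

lemma lookup_of_nat_mult:
  "Poly_Mapping.lookup (of_nat k * (p :: rpoly)) m = of_nat k * Poly_Mapping.lookup p m"
  by (induction k) (simp_all add: distrib_right lookup_add algebra_simps)

lemma lookup_sg_term:
  "Poly_Mapping.lookup (sg_term S z T s r t) m = sg_term S z T s (Poly_Mapping.lookup r m) t"
  for r :: rpoly
  by (simp add: sg_term_def)

text \<open>Makes the \<open>finsum\<close> inside \<open>mat_mult\<close> computable, since its
  rules live over commutative additive monoids.\<close>

lemma abelian_monoid_signed_group_ring:
  "abelian_monoid (signed_group_ring S z T :: ('a \<Rightarrow> 'r::comm_ring_1) ring)"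
proof (rule abelian_monoidI)
  fix f g assume "f \<in> carrier (signed_group_ring S z T :: ('a \<Rightarrow> 'r) ring)"
    and "g \<in> carrier (signed_group_ring S z T :: ('a \<Rightarrow> 'r) ring)"
  then have "finite ({s. f s \<noteq> 0} \<union> {s. g s \<noteq> 0})" "{s. f s \<noteq> 0} \<union> {s. g s \<noteq> 0} \<subseteq> T"
    by (auto simp: signed_group_ring_def)
  moreover have "{s. f s + g s \<noteq> 0} \<subseteq> {s. f s \<noteq> 0} \<union> {s. g s \<noteq> 0}" by auto
  ultimately show "f \<oplus>\<^bsub>signed_group_ring S z T\<^esub> g \<in> carrier (signed_group_ring S z T)"
    unfolding signed_group_ring_def by (auto intro: finite_subset)
qed (auto simp: signed_group_ring_def algebra_simps)

lemma finsum_signed_group_ring: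
  fixes f :: "'i \<Rightarrow> 'a \<Rightarrow> 'r::comm_ring_1"
  assumes "finite I" "\<And>i. i \<in> I \<Longrightarrow> f i \<in> carrier (signed_group_ring S z T)"
  shows "finsum (signed_group_ring S z T) f I = (\<lambda>t. \<Sum>i\<in>I. f i t)"
  using assms
proof (induction I)
  case empty
  interpret abelian_monoid "signed_group_ring S z T :: ('a \<Rightarrow> 'r) ring"
    by (rule abelian_monoid_signed_group_ring)
  show ?case unfolding finsum_empty by (simp add: signed_group_ring_def)
next
  case (insert i I)
  interpret abelian_monoid "signed_group_ring S z T :: ('a \<Rightarrow> 'r) ring"
    by (rule abelian_monoid_signed_group_ring)
  have "finsum (signed_group_ring S z T) f (insert i I) =
      f i \<oplus>\<^bsub>signed_group_ring S z T\<^esub> finsum (signed_group_ring S z T) f I"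
    using insert by (intro finsum_insert) auto
  also have "\<dots> = (\<lambda>t. \<Sum>i\<in>insert i I. f i t)"
    using insert by (simp add: signed_group_ring_def)
  finally show ?case .
qed

lemma sg_term_closed:
  "sg_term S z T s r \<in> carrier (signed_group_ring S z T)"
proof -
  have "{t. sg_term S z T s r t \<noteq> 0} \<subseteq> {s, z \<otimes>\<^bsub>S\<^esub> s} \<inter> T"
    by (auto simp: sg_term_def split: if_splits)
  moreover have "finite ({s, z \<otimes>\<^bsub>S\<^esub> s} \<inter> T)" by simp
  ultimately show ?thesis
    unfolding signed_group_ring_def using finite_subset by fastforce
qed

section \<open>Single terms over a transversal: normal form, products, cancellation\<close>

locale signed_group_transversal = signed_group +
  fixes T
  assumes T: "transversal S (generate S {z}) T"
begin

lemma z_square: "z \<otimes> z = \<one>"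
  using pow_ord_eq_1[OF z_closed] z_ord z_closed by (simp add: numeral_2_eq_2)

lemma z_neq_one: "z \<noteq> \<one>"
  using z_ord ord_eq_1[OF z_closed] by auto

lemma inv_z: "inv z = z"
  using z_square z_closed inv_equality by blast

lemma z_z: "s \<in> carrier S \<Longrightarrow> z \<otimes> (z \<otimes> s) = s"
  using z_square z_closed by (simp add: m_assoc[symmetric])

lemma z_mult_neq: "s \<in> carrier S \<Longrightarrow> z \<otimes> s \<noteq> s"
  using z_neq_one z_closed by (metis l_one one_closed right_cancel)

lemma z_mult_left: "s \<in> carrier S \<Longrightarrow> t \<in> carrier S \<Longrightarrow> s \<otimes> (z \<otimes> t) = z \<otimes> (s \<otimes> t)"
  using z_closed z_central by (metis m_assoc)

lemma generate_z: "generate S {z} = {\<one>, z}"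
proof
  show "{\<one>, z} \<subseteq> generate S {z}" by (auto intro: generate.intros)
  show "generate S {z} \<subseteq> {\<one>, z}"
  proof
    fix x assume "x \<in> generate S {z}"
    then show "x \<in> {\<one>, z}"
      by (induction) (use inv_z z_square z_closed in auto)
  qed
qed

lemma T_subset: "T \<subseteq> carrier S"
  using T by (simp add: transversal_def)

lemma mem_T_iff:
  assumes s: "s \<in> carrier S"
  shows "z \<otimes> s \<in> T \<longleftrightarrow> s \<notin> T"
proof -
  have "{\<one>, z} #> s \<in> rcosets {\<one>, z}" using s by (auto simp: RCOSETS_def)
  moreover have "{\<one>, z} #> s = {s, z \<otimes> s}" using s by (auto simp: r_coset_def)
  ultimately have "\<exists>!t. t \<in> T \<inter> {s, z \<otimes> s}" using T unfolding transversal_def generate_z by metis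
  then show ?thesis using z_mult_neq[OF s] by auto
qed

lemma sg_term_z:
  assumes "s \<in> carrier S"
  shows "sg_term S z T (z \<otimes> s) (- r) = sg_term S z T s r"
  using assms z_mult_neq[OF assms] by (auto simp: sg_term_def z_z fun_eq_iff)

lemma sg_term_in_T:
  assumes "s \<in> T"
  shows "sg_term S z T s r = (\<lambda>t. if t = s then r else 0)"
  using assms T_subset mem_T_iff[of s] by (auto simp: sg_term_def fun_eq_iff)

text \<open>Moving the group element into \<open>T\<close> costs at most a sign, and for elements of
  \<open>T\<close> a term is a point mass by \<open>sg_term_in_T\<close>. Calculations with terms
  reduce to that case.\<close>

lemma sg_term_representative:
  assumes "s \<in> carrier S"
  obtains a \<sigma> where "a \<in> T" "a = s \<and> \<sigma> = r \<or> a = z \<otimes> s \<and> \<sigma> = - r"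
    "sg_term S z T s r = sg_term S z T a \<sigma>"
  using assms mem_T_iff[OF assms] sg_term_z[OF assms, of r] that by metis

lemma sg_term_mult:
  assumes s: "s \<in> carrier S" and t: "t \<in> carrier S"
  shows "sg_term S z T s x \<otimes>\<^bsub>signed_group_ring S z T\<^esub> sg_term S z T t y =
    sg_term S z T (s \<otimes> t) (x * y)"
proof -
  obtain a u where a: "a \<in> T" "a = s \<and> u = x \<or> a = z \<otimes> s \<and> u = - x"
    "sg_term S z T s x = sg_term S z T a u" using s by (rule sg_term_representative)
  obtain b v where b: "b \<in> T" "b = t \<and> v = y \<or> b = z \<otimes> t \<and> v = - y"
    "sg_term S z T t y = sg_term S z T b v" using t by (rule sg_term_representative)
  have supp: "{k. (if k = c then w else 0) \<noteq> 0} = (if w = 0 then {} else {c})" for c :: 'a and w :: 'c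
    by auto
  have "sg_term S z T a u \<otimes>\<^bsub>signed_group_ring S z T\<^esub> sg_term S z T b v =
      sg_term S z T (a \<otimes> b) (u * v)"
    using a(1) b(1)
    by (auto simp: signed_group_ring_def sg_term_in_T supp) (auto simp: sg_term_def)
  also have "\<dots> = sg_term S z T (s \<otimes> t) (x * y)"
    using a(2) b(2) s t z_closed sg_term_z[of "s \<otimes> t" "x * y"]
    by (auto simp: m_assoc z_mult_left[OF s t] z_z)
  finally show ?thesis using a(3) b(3) by simp
qed

lemma sg_conj_sg_term:
  assumes s: "s \<in> carrier S"
  shows "sg_conj S z T (sg_term S z T s x) = sg_term S z T (inv s) x"
proof -
  obtain a u where a: "a \<in> T" "a = s \<and> u = x \<or> a = z \<otimes> s \<and> u = - x"
    "sg_term S z T s x = sg_term S z T a u" using s by (rule sg_term_representative)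
  have supp: "{k. (if k = a then u else 0) \<noteq> 0} = (if u = 0 then {} else {a})"
    by auto
  have "sg_conj S z T (sg_term S z T a u) = sg_term S z T (inv a) u"
    using a(1) by (auto simp: sg_conj_def sg_term_in_T supp) (auto simp: sg_term_def)
  also have "\<dots> = sg_term S z T (inv s) x"
    using a(2) s z_closed sg_term_z[of "inv s" x] z_central
    by (auto simp: inv_mult_group inv_z)
  finally show ?thesis using a(3) by simp
qed

text \<open>Adding up all coefficients sends each term to 1 or -1, according to whether
  \<open>g l\<close> lies in \<open>T\<close>. The total is 0, so both values occur equally
  often.\<close>

lemma sg_term_cancel_even:
  fixes g :: "nat \<Rightarrow> 'a"
  assumes D: "finite D" and g: "\<And>l. l \<in> D \<Longrightarrow> g l \<in> carrier S"
    and zero: "\<And>t. (\<Sum>l\<in>D. sg_term S z T (g l) (1::real) t) = 0"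
  shows "even (card D)"
proof -
  \<comment> \<open>A finite set containing the support of every term, so that sums over
    \<open>W\<close> add up all coefficients.\<close>
  define W where "W = (g ` D \<union> (\<lambda>l. z \<otimes> g l) ` D)"
  define P where "P = {l \<in> D. g l \<in> T}"
  have W: "finite W" using D by (simp add: W_def)
  have one: "(\<Sum>t\<in>W. sg_term S z T (g l) (1::real) t) = (if l \<in> P then 1 else -1)" if l: "l \<in> D" for l
  proof -
    obtain a u where a: "a \<in> T" "a = g l \<and> u = (1::real) \<or> a = z \<otimes> g l \<and> u = - 1"
      "sg_term S z T (g l) 1 = sg_term S z T a u" using g[OF l] by (rule sg_term_representative)
    have "a \<in> W" using a(2) l by (auto simp: W_def)
    then have "(\<Sum>t\<in>W. sg_term S z T (g l) (1::real) t) = u"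
      using W by (simp add: a(3) sg_term_in_T[OF a(1)])
    moreover have "u = (if l \<in> P then 1 else -1)"
      using a(1,2) l mem_T_iff[OF g[OF l]] by (auto simp: P_def)
    ultimately show ?thesis by simp
  qed
  have "0 = (\<Sum>t\<in>W. \<Sum>l\<in>D. sg_term S z T (g l) (1::real) t)" using zero by simp
  also have "\<dots> = (\<Sum>l\<in>D. if l \<in> P then 1 else -1)"
    by (subst sum.swap) (simp add: one)
  also have "\<dots> = (\<Sum>l\<in>P. 1) + (\<Sum>l\<in>D - P. -1)"
    using D by (subst sum.subset_diff[of P]) (auto simp: P_def intro!: sum.cong)
  finally have "card P = card (D - P)" by simp
  moreover have "card D = card P + card (D - P)"
    using D by (metis (no_types, lifting) P_def card_Diff_subset card_mono finite_subset
      le_add_diff_inverse mem_Collect_eq subsetI)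
  ultimately show ?thesis by simp
qed

text \<open>Two point masses cancel only at the same element of \<open>T\<close> and with opposite
  coefficients, so exactly one of \<open>g\<close> and \<open>h\<close> was moved by
  \<open>z\<close> to reach it.\<close>

lemma sg_term_cancel_pair:
  assumes g: "g \<in> carrier S" "h \<in> carrier S"
    and zero: "\<And>t. sg_term S z T g (1::real) t + sg_term S z T h 1 t = 0"
  shows "g = z \<otimes> h"
proof -
  obtain a u where a: "a \<in> T" "a = g \<and> u = (1::real) \<or> a = z \<otimes> g \<and> u = - 1"
    "sg_term S z T g 1 = sg_term S z T a u" using g(1) by (rule sg_term_representative)
  obtain b v where b: "b \<in> T" "b = h \<and> v = (1::real) \<or> b = z \<otimes> h \<and> v = - 1"
    "sg_term S z T h 1 = sg_term S z T b v" using g(2) by (rule sg_term_representative)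
  have "(if a = a then u else 0) + (if a = b then v else 0) = 0"
    using zero[of a] by (simp add: a(3) b(3) sg_term_in_T[OF a(1)] sg_term_in_T[OF b(1)])
  then show ?thesis using a(2) b(2) g z_z by (auto split: if_splits)
qed


section \<open>Products of rows, and the coefficients of their monomials\<close>

lemma SOD_row_product:
  assumes SOD: "is_SOD S z T n us A"
    and A: "\<And>i l. i < n \<Longrightarrow> l < n \<Longrightarrow> e i l \<in> carrier S \<and> A i l = sg_term S z T (e i l) (p i l)"
    and i: "i < n" and j: "j < n"
  shows "(\<Sum>l<n. sg_term S z T (e i l \<otimes> inv (e j l)) (p i l * p j l) t) =
    (if i = j then sg_term S z T \<one> (\<Sum>v<length us. of_nat (us ! v) * Var v ^ 2) t else 0)"
proof -
  have entry: "A i l \<otimes>\<^bsub>signed_group_ring S z T\<^esub> conj_transpose S z T A l j =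
      sg_term S z T (e i l \<otimes> inv (e j l)) (p i l * p j l)" if "l < n" for l
    using A[OF i that] A[OF j that] by (simp add: conj_transpose_def sg_conj_sg_term sg_term_mult)
  have "mat_mult (signed_group_ring S z T) n A (conj_transpose S z T A) i j =
      (\<lambda>t. \<Sum>l<n. (A i l \<otimes>\<^bsub>signed_group_ring S z T\<^esub> conj_transpose S z T A l j) t)"
    unfolding mat_mult_def by (rule finsum_signed_group_ring) (simp_all add: entry sg_term_closed)
  also have "\<dots> = (\<lambda>t. \<Sum>l<n. sg_term S z T (e i l \<otimes> inv (e j l)) (p i l * p j l) t)"
    by (simp add: entry)
  finally have prod: "mat_mult (signed_group_ring S z T) n A (conj_transpose S z T A) i j t =
      (\<Sum>l<n. sg_term S z T (e i l \<otimes> inv (e j l)) (p i l * p j l) t)" by simp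
  have "mat_mult (signed_group_ring S z T) n A (conj_transpose S z T A) i j =
       (if i = j then sg_term S z T \<one> (\<Sum>v<length us. of_nat (us ! v) * Var v ^ 2)
        else \<zero>\<^bsub>signed_group_ring S z T\<^esub>)"
    using SOD i j unfolding is_SOD_def by blast
  then show ?thesis unfolding prod[symmetric] by (simp add: signed_group_ring_def)
qed

text \<open>A zero entry is also written as a term, with coefficient 0 at the unit, so that all
  entries have the one shape that \<open>SOD_row_product\<close> expects.\<close>

lemma SOD_entries:
  assumes "is_SOD S z T n us A"
  obtains e p where
    "\<And>i l. i < n \<Longrightarrow> l < n \<Longrightarrow> e i l \<in> carrier S \<and> A i l = sg_term S z T (e i l) (p i l)"
    "\<And>i l. i < n \<Longrightarrow> l < n \<Longrightarrow> p i l = 0 \<or> (\<exists>v<length us. p i l = Var v)"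
proof -
  define good where "good i l x \<longleftrightarrow> fst x \<in> carrier S \<and> A i l = sg_term S z T (fst x) (snd x) \<and>
    (snd x = 0 \<or> (\<exists>v<length us. snd x = Var v))" for i l x
  have "\<exists>x. good i l x" if il: "i < n" "l < n" for i l
  proof -
    have zero: "\<zero>\<^bsub>signed_group_ring S z T\<^esub> = sg_term S z T \<one> (0 :: rpoly)"
      by (auto simp: signed_group_ring_def sg_term_def)
    consider "A i l = \<zero>\<^bsub>signed_group_ring S z T\<^esub>"
      | s v where "s \<in> carrier S" "v < length us" "A i l = sg_term S z T s (Var v)"
      using assms il unfolding is_SOD_def by blast
    then show ?thesis
    proof cases
      case 1
      then have "good i l (\<one>, 0)" by (simp add: good_def zero)
      then show ?thesis ..
    next
      case (2 s v)
      then have "good i l (s, Var v)" by (auto simp: good_def)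
      then show ?thesis ..
    qed
  qed
  then have "good i l (SOME x. good i l x)" if "i < n" "l < n" for i l
    using that by (blast intro: someI_ex)
  then show ?thesis
    by (intro that[of "\<lambda>i l. fst (SOME x. good i l x)" "\<lambda>i l. snd (SOME x. good i l x)"])
      (simp_all add: good_def)
qed

lemma SOD_row_count:
  assumes SOD: "is_SOD S z T n us A"
    and A: "\<And>i l. i < n \<Longrightarrow> l < n \<Longrightarrow> e i l \<in> carrier S \<and> A i l = sg_term S z T (e i l) (p i l)"
    and p: "\<And>i l. i < n \<Longrightarrow> l < n \<Longrightarrow> p i l = 0 \<or> (\<exists>v<length us. p i l = Var v)"
    and i: "i < n" and v: "v < length us"
  shows "card {l. l < n \<and> p i l = Var v} = us ! v"
proof -
  let ?m = "Poly_Mapping.single v 1 + Poly_Mapping.single v 1 :: nat \<Rightarrow>\<^sub>0 nat"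
  \<comment> \<open>The unit need not lie in \<open>T\<close>: \<open>a\<close> represents its
    coset, and \<open>u\<close> is the resulting sign, which cancels from both sides.\<close>
  obtain a where a: "a \<in> T" "a = \<one> \<or> a = z"
    using mem_T_iff[of \<one>] z_closed by auto
  define u :: real where "u = (if a = \<one> then 1 else -1)"
  have u: "u \<noteq> 0" by (simp add: u_def)
  have coeff: "sg_term S z T \<one> r a = u * r" for r
    using a z_neq_one z_closed by (auto simp: sg_term_def u_def)
  have "e i l \<otimes> inv (e i l) = \<one>" if "l < n" for l
    using A[OF i that] by simp
  then have "(\<Sum>l<n. sg_term S z T \<one> (p i l * p i l) a) =
      sg_term S z T \<one> (\<Sum>w<length us. of_nat (us ! w) * Var w ^ 2) a"
    using SOD_row_product[OF SOD A i i, where t = a] by simp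
  from arg_cong[OF this, of "\<lambda>q. Poly_Mapping.lookup q ?m"]
  have "(\<Sum>l<n. u * Poly_Mapping.lookup (p i l * p i l) ?m) =
      u * (\<Sum>w<length us. us ! w * Poly_Mapping.lookup (Var w * Var w) ?m)"
    by (simp add: lookup_sum lookup_sg_term coeff lookup_of_nat_mult power2_eq_square)
  then have "(\<Sum>l<n. Poly_Mapping.lookup (p i l * p i l) ?m) =
      (\<Sum>w<length us. us ! w * Poly_Mapping.lookup (Var w * Var w) ?m)"
    using u by (simp add: sum_distrib_left[symmetric])
  moreover have "(\<Sum>l<n. Poly_Mapping.lookup (p i l * p i l) ?m) =
      (\<Sum>l<n. if p i l = Var v then 1 else 0)"
    using p[OF i] by (intro sum.cong refl lookup_Var_or_zero_square) auto
  moreover have "(\<Sum>w<length us. us ! w * Poly_Mapping.lookup (Var w * Var w) ?m) =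
      (\<Sum>w<length us. if w = v then real (us ! w) else 0)"
    by (intro sum.cong refl) (simp add: lookup_Var_mult[unfolded One_nat_def])
  ultimately have "(\<Sum>l<n. if p i l = Var v then 1 else 0) = real (us ! v)"
    using v by simp
  then show ?thesis by (simp add: sum.If_cases Int_def)
qed

end

text \<open>
  A design with \<open>u\<^sub>1 + \<dots> + u\<^sub>k = n\<close> has no zero entries; \<open>c i l\<close> and \<open>e i l\<close> are the index of the
  variable and the group element in position \<open>(i, l)\<close>.  In \<open>cancel\<close>, the set \<open>{a, b}\<close> stands for the
  monomial \<open>x\<^sub>a x\<^sub>b\<close>, including \<open>x\<^sub>a\<^sup>2\<close> when \<open>a = b\<close>.
\<close>

locale full_SOD = signed_group_transversal +
  fixes n :: nat and us :: "nat list" and c :: "nat \<Rightarrow> nat \<Rightarrow> nat" and e :: "nat \<Rightarrow> nat \<Rightarrow> 'a"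
  assumes e_closed: "\<And>i l. i < n \<Longrightarrow> l < n \<Longrightarrow> e i l \<in> carrier S"
    and c_less: "\<And>i l. i < n \<Longrightarrow> l < n \<Longrightarrow> c i l < length us"
    and c_card: "\<And>i v. i < n \<Longrightarrow> v < length us \<Longrightarrow> card {l. l < n \<and> c i l = v} = us ! v"
    and cancel: "\<And>i j a b t. i < n \<Longrightarrow> j < n \<Longrightarrow> i \<noteq> j \<Longrightarrow>
      (\<Sum>l | l < n \<and> {c i l, c j l} = {a, b}. sg_term S z T (e i l \<otimes> inv (e j l)) (1::real) t) = 0"

text \<open>The column sets of the variables in a row are disjoint and their sizes add up to
  \<open>n\<close>, so they leave no column for a zero. The condition \<open>cancel\<close> is the
  coefficient of the monomial of \<open>a\<close> and \<open>b\<close> in the vanishing product of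
  two distinct rows.\<close>

lemma (in signed_group_transversal) full_SOD_of_SOD:
  assumes SOD: "is_SOD S z T n us A" and full: "sum_list us = n"
  obtains c e where "full_SOD S z T n us c e"
proof -
  obtain e p where
    A: "\<And>i l. i < n \<Longrightarrow> l < n \<Longrightarrow> e i l \<in> carrier S \<and> A i l = sg_term S z T (e i l) (p i l)"
    and p: "\<And>i l. i < n \<Longrightarrow> l < n \<Longrightarrow> p i l = 0 \<or> (\<exists>v<length us. p i l = Var v)"
    using SOD_entries[OF SOD] by metis
  have count: "card {l. l < n \<and> p i l = Var v} = us ! v" if "i < n" "v < length us" for i v
    by (rule SOD_row_count[where e = e, OF SOD _ _ that]) (use A p in auto)
  have var: "\<exists>v<length us. p i l = Var v" if i: "i < n" and l: "l < n" for i l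
  proof -
    let ?L = "\<lambda>v. {l. l < n \<and> p i l = Var v}"
    have "card (\<Union>v<length us. ?L v) = (\<Sum>v<length us. card (?L v))"
      by (rule card_UN_disjoint) (auto simp: Var_eq_iff)
    also have "\<dots> = (\<Sum>v<length us. us ! v)" using count[OF i] by simp
    also have "\<dots> = n" using full by (simp add: sum_list_sum_nth atLeast0LessThan)
    finally have "(\<Union>v<length us. ?L v) = {..<n}" by (intro card_subset_eq) auto
    then show ?thesis using l by blast
  qed
  define c where "c i l = (SOME v. v < length us \<and> p i l = Var v)" for i l
  have c: "c i l < length us \<and> p i l = Var (c i l)" if "i < n" "l < n" for i l
    unfolding c_def by (rule someI_ex) (use var[OF that] in blast)
  show ?thesis
  proof (rule that[of c e], unfold_locales)
    show "e i l \<in> carrier S" if "i < n" "l < n" for i l using A[OF that] ..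
    show "c i l < length us" if "i < n" "l < n" for i l using c[OF that] ..
    show "card {l. l < n \<and> c i l = v} = us ! v" if "i < n" "v < length us" for i v
    proof -
      have "{l. l < n \<and> c i l = v} = {l. l < n \<and> p i l = Var v}"
        using c[OF that(1)] by (auto simp: Var_eq_iff)
      then show ?thesis using count[OF that] by simp
    qed
    show "(\<Sum>l | l < n \<and> {c i l, c j l} = {a, b}. sg_term S z T (e i l \<otimes> inv (e j l)) (1::real) t) = 0"
      if ij: "i < n" "j < n" "i \<noteq> j" for i j a b t
    proof -
      let ?m = "Poly_Mapping.single a 1 + Poly_Mapping.single b 1 :: nat \<Rightarrow>\<^sub>0 nat"
      have "0 = Poly_Mapping.lookup
          (\<Sum>l<n. sg_term S z T (e i l \<otimes> inv (e j l)) (p i l * p j l) t) ?m"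
        using SOD_row_product[OF SOD A ij(1,2), where t = t] ij(3) by simp
      also have "\<dots> = (\<Sum>l<n. sg_term S z T (e i l \<otimes> inv (e j l))
          (Poly_Mapping.lookup (p i l * p j l) ?m) t)"
        by (simp add: lookup_sum lookup_sg_term)
      also have "\<dots> = (\<Sum>l<n. if {c i l, c j l} = {a, b}
          then sg_term S z T (e i l \<otimes> inv (e j l)) 1 t else 0)"
        using c ij by (intro sum.cong refl) (simp add: lookup_Var_mult[unfolded One_nat_def] sg_term_def)
      also have "\<dots> = (\<Sum>l | l < n \<and> {c i l, c j l} = {a, b}.
          sg_term S z T (e i l \<otimes> inv (e j l)) 1 t)"
        by (simp add: sum.If_cases Int_def)
      finally show ?thesis by simp
    qed
  qed
qed

section \<open>Triples with even intersections\<close>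

lemma no_six_triples_even_intersections:
  fixes R :: "nat \<Rightarrow> nat set"
  assumes sub: "\<And>i. i < 6 \<Longrightarrow> R i \<subseteq> {..<6}" and card3: "\<And>i. i < 6 \<Longrightarrow> card (R i) = 3"
    and ev: "\<And>i j. i < 6 \<Longrightarrow> j < 6 \<Longrightarrow> i \<noteq> j \<Longrightarrow> even (card (R i \<inter> R j))"
  shows False
proof -
  have fin: "finite (R i)" if "i < 6" for i using sub[OF that] finite_subset by blast
  have two: "card (R i \<inter> R j) = 2" if ij: "i < 6" "j < 6" "i \<noteq> j" for i j
  proof -
    have "card (R i \<inter> R j) \<noteq> 0"
    proof
      assume "card (R i \<inter> R j) = 0"
      then have disj: "R i \<inter> R j = {}" using fin ij by simp
      have "card (R i \<union> R j) = 6" using disj fin ij card3 by (simp add: card_Un_disjoint)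
      then have all: "R i \<union> R j = {..<6}" using sub ij by (intro card_subset_eq) auto
      have "\<not> {..<6} \<subseteq> {i, j}"
      proof
        assume "{..<6} \<subseteq> {i, j}"
        then have "card {..<6::nat} \<le> card {i, j}" by (intro card_mono) auto
        then show False by (simp add: card_insert_if split: if_splits)
      qed
      then obtain k where k: "k < 6" "k \<noteq> i" "k \<noteq> j" by auto
      have "R k = (R k \<inter> R i) \<union> (R k \<inter> R j)" using all sub[OF k(1)] by auto
      then have "card (R k) = card (R k \<inter> R i) + card (R k \<inter> R j)"
        using disj fin k ij by (subst card_Un_disjoint[symmetric]) auto
      then show False using card3[OF k(1)] ev[OF k(1) ij(1) k(2)] ev[OF k(1) ij(2) k(3)]
        by (metis even_add odd_numeral)
    qed
    moreover have "card (R i \<inter> R j) \<le> 3"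
      using card_mono[OF fin[OF ij(1)], of "R i \<inter> R j"] card3[OF ij(1)] by auto
    ultimately show ?thesis using ev[OF ij] by presburger
  qed
  have inj: "inj_on R {..<6}"
  proof (rule inj_onI)
    fix i j assume ij: "i \<in> {..<6::nat}" "j \<in> {..<6::nat}" "R i = R j"
    show "i = j"
    proof (rule ccontr)
      assume "i \<noteq> j"
      then show False using two[of i j] card3[of i] ij by simp
    qed
  qed
  obtain p q where pq: "R 0 \<inter> R 1 = {p, q}" "p \<noteq> q" using two[of 0 1] by (auto simp: card_2_iff)
  have "card (R 0 - {p, q}) = 1" "card (R 1 - {p, q}) = 1"
    using pq card3[of 0] card3[of 1] by (subst card_Diff_subset; auto)+
  then obtain r s where rs: "R 0 - {p, q} = {r}" "R 1 - {p, q} = {s}" by (auto simp: card_1_singleton_iff)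
  then have R01: "R 0 = {p, q, r}" "R 1 = {p, q, s}" using pq by auto
  define U where "U = {p, q, r, s}"
  have dist: "r \<noteq> s" "r \<noteq> p" "r \<noteq> q" "s \<noteq> p" "s \<noteq> q" using rs pq R01 by auto
  have cU: "card U = 4" using dist pq by (simp add: U_def)
  have U: "U \<subseteq> {..<6}" using sub[of 0] sub[of 1] R01 by (auto simp: U_def)
  \<comment> \<open>A triple missing \<open>y\<close> can meet \<open>R 0\<close> only in
    \<open>x\<close>, \<open>r\<close> and \<open>R 1\<close> only in \<open>x\<close>,
    \<open>s\<close>; both intersections have size two, so it contains all three points.\<close>
  have triple: "R k = {x, r, s}"
    if k: "k < 6" "1 < k" and x: "x = p \<and> y = q \<or> x = q \<and> y = p" and y: "y \<notin> R k" for k x y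
  proof -
    have "R k \<inter> R 0 = R k \<inter> {x, r}" "R k \<inter> R 1 = R k \<inter> {x, s}" using R01 x y by auto
    then have c2: "card (R k \<inter> {x, r}) = 2" "card (R k \<inter> {x, s}) = 2"
      using two[of k 0] two[of k 1] k by auto
    have "R k \<inter> {x, w} = {x, w}" if "card (R k \<inter> {x, w}) = 2" for w
      using that by (intro card_seteq) (auto simp: card_insert_if)
    then have "{x, r, s} \<subseteq> R k" using c2 by blast
    moreover have "card {x, r, s} = 3" using dist x by auto
    ultimately show ?thesis using card3[OF k(1)] fin[OF k(1)] by (metis card_subset_eq)
  qed
  have "R ` {..<6} \<subseteq> (\<lambda>x. {p, q, x}) ` ({..<6} - {p, q}) \<or> R ` {..<6} \<subseteq> (\<lambda>x. U - {x}) ` U"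
  proof (cases "\<forall>k<6. {p, q} \<subseteq> R k")
    case True
    have "R k \<in> (\<lambda>x. {p, q, x}) ` ({..<6} - {p, q})" if k: "k < 6" for k
    proof -
      have "card (R k - {p, q}) = 1"
        using True k pq(2) card3[OF k] by (subst card_Diff_subset) auto
      then obtain x where "R k - {p, q} = {x}" by (auto simp: card_1_singleton_iff)
      then have "R k = {p, q, x}" "x \<in> {..<6} - {p, q}" using True k sub[OF k] by auto
      then show ?thesis by blast
    qed
    then show ?thesis by blast
  next
    case False
    then obtain m where m: "m < 6" "\<not> {p, q} \<subseteq> R m" by blast
    then have m1: "1 < m" using R01 by (cases "m = 0"; cases "m = 1") auto
    have Rm: "R m = {p, r, s} \<or> R m = {q, r, s}"
      using triple[OF m(1) m1, of p q] triple[OF m(1) m1, of q p] m(2) by auto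
    \<comment> \<open>A triple leaving \<open>U\<close> contains \<open>p\<close> and
      \<open>q\<close> by \<open>triple\<close>, and its third point lies outside \<open>U\<close>;
      it then meets \<open>R m\<close> in at most one point.\<close>
    have *: "R k \<subseteq> U" if k: "k < 6" for k
    proof (rule ccontr)
      assume nU: "\<not> R k \<subseteq> U"
      then have k1: "1 < k" using R01 by (cases "k = 0"; cases "k = 1") (auto simp: U_def)
      have "p \<in> R k" "q \<in> R k"
        using triple[OF k k1, of p q] triple[OF k k1, of q p] nU by (auto simp: U_def)
      moreover obtain x where "x \<in> R k" "x \<notin> U" using nU by blast
      moreover have "card {p, q, x} = 3" using \<open>x \<notin> U\<close> pq(2) by (auto simp: U_def)
      ultimately have "R k = {p, q, x}"
        using card3[OF k] fin[OF k] by (metis card_subset_eq empty_subsetI insert_subset)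
      then have "R k \<inter> R m \<subseteq> {p} \<or> R k \<inter> R m \<subseteq> {q}"
        using Rm \<open>x \<notin> U\<close> dist pq(2) by (auto simp: U_def)
      then have "card (R k \<inter> R m) \<le> 1"
        using card_mono[of "{p}" "R k \<inter> R m"] card_mono[of "{q}" "R k \<inter> R m"] by auto
      moreover have "k \<noteq> m" using Rm nU by (auto simp: U_def)
      ultimately show False using two[OF k m(1)] by simp
    qed
    have "R k \<in> (\<lambda>x. U - {x}) ` U" if k: "k < 6" for k
    proof -
      have "card (U - R k) = 1" using *[OF k] fin[OF k] cU card3[OF k] by (simp add: card_Diff_subset)
      then obtain x where "U - R k = {x}" by (auto simp: card_1_singleton_iff)
      then have "R k = U - {x}" "x \<in> U" using *[OF k] by auto
      then show ?thesis by blast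
    qed
    then show ?thesis by blast
  qed
  moreover have "card (R ` {..<6}) = 6" using inj by (simp add: card_image)
  moreover have "card ((\<lambda>x. {p, q, x}) ` ({..<6} - {p, q})) \<le> 4"
  proof -
    have "card ({..<6} - {p, q}) = 4" using pq U by (subst card_Diff_subset) (auto simp: U_def)
    then show ?thesis using card_image_le[of "{..<6} - {p, q}"] by (metis finite_Diff finite_lessThan)
  qed
  moreover have "card ((\<lambda>x. U - {x}) ` U) \<le> 4"
    using card_image_le[of U "\<lambda>x. U - {x}"] cU by (simp add: U_def)
  moreover have "finite ((\<lambda>x. {p, q, x}) ` ({..<6} - {p, q}))" "finite ((\<lambda>x. U - {x}) ` U)"
    by (auto simp: U_def)
  ultimately show False
    using card_mono[of "(\<lambda>x. {p, q, x}) ` ({..<6} - {p, q})" "R ` {..<6}"]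
      card_mono[of "(\<lambda>x. U - {x}) ` U" "R ` {..<6}"] by linarith
qed

lemma card_ge_3_obtain:
  assumes "3 \<le> card A"
  obtains x y w where "x \<in> A" "y \<in> A" "w \<in> A" "x \<noteq> y" "x \<noteq> w" "y \<noteq> w"
proof -
  obtain B where "B \<subseteq> A" "card B = 3" using obtain_subset_with_card_n[OF assms] by metis
  then show ?thesis using that by (auto simp: card_3_iff)
qed

section \<open>Pairs of rows of a design without zeros\<close>

context full_SOD
begin

lemma even_columns:
  assumes "i < n" "j < n" "i \<noteq> j"
  shows "even (card {l. l < n \<and> {c i l, c j l} = {a, b}})"
  by (rule sg_term_cancel_even[where g = "\<lambda>l. e i l \<otimes> inv (e j l)"])
    (use assms cancel e_closed in auto)

text \<open>Since \<open>z\<close> is central, a relation \<open>e i l \<otimes> inv (e j l) = z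
  \<otimes> (e i l' \<otimes> inv (e j l'))\<close> can be rearranged so that each side involves one
  row only. In a noncommutative group this dictates the order of the factors.\<close>

definition ratio :: "nat \<Rightarrow> nat \<Rightarrow> nat \<Rightarrow> 'a" where
  "ratio i l l' = inv (e i l') \<otimes> e i l"

lemma ratio_closed: "i < n \<Longrightarrow> l < n \<Longrightarrow> l' < n \<Longrightarrow> ratio i l l' \<in> carrier S"
  by (simp add: ratio_def e_closed)

lemma ratio_trans:
  assumes "i < n" "k < n" "l < n" "m < n"
  shows "ratio i k m = ratio i l m \<otimes> ratio i k l"
proof -
  have "e i l \<otimes> (inv (e i l) \<otimes> e i k) = e i k"
    using assms e_closed by (simp add: m_assoc[symmetric])
  then show ?thesis using assms e_closed by (simp add: ratio_def m_assoc)
qed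

lemma ratio_opposite:
  assumes ij: "i < n" "j < n" "i \<noteq> j" and l: "l < n" "l' < n" "l \<noteq> l'"
    and only: "{k. k < n \<and> {c i k, c j k} = {a, b}} = {l, l'}"
  shows "ratio i l l' = z \<otimes> ratio j l l'"
proof -
  note cl = e_closed[OF ij(1) l(1)] e_closed[OF ij(1) l(2)] e_closed[OF ij(2) l(1)]
    e_closed[OF ij(2) l(2)]
  have "e i l \<otimes> inv (e j l) = z \<otimes> (e i l' \<otimes> inv (e j l'))"
    using cancel[OF ij, of _ a b] cl l(3) by (intro sg_term_cancel_pair) (simp_all add: only)
  then have "inv (e i l') \<otimes> (e i l \<otimes> inv (e j l)) \<otimes> e j l =
      inv (e i l') \<otimes> (z \<otimes> (e i l' \<otimes> inv (e j l'))) \<otimes> e j l" by simp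
  moreover have "inv (e i l') \<otimes> (e i l \<otimes> inv (e j l)) \<otimes> e j l = ratio i l l'"
    using cl by (simp add: ratio_def m_assoc)
  moreover have "inv (e i l') \<otimes> (z \<otimes> (e i l' \<otimes> inv (e j l'))) \<otimes> e j l =
      z \<otimes> ((inv (e i l') \<otimes> e i l') \<otimes> (inv (e j l') \<otimes> e j l))"
    using cl z_closed z_mult_left[of "inv (e i l')" "e i l' \<otimes> inv (e j l')"]
    by (simp add: m_assoc inv_solve_left')
  moreover have "\<dots> = z \<otimes> ratio j l l'" using cl by (simp add: ratio_def)
  ultimately show ?thesis by simp
qed

text \<open>Two rows opposite to the same row have equal quotients, and no group element is its own
  negative.\<close>

lemma no_three_opposite:
  assumes "j < n" "l < n" "l' < n"
    and "ratio i l l' = z \<otimes> ratio j l l'" "ratio i l l' = z \<otimes> ratio k l l'"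
    and "ratio j l l' = z \<otimes> ratio k l l'"
  shows False
proof -
  have "z \<otimes> ratio j l l' = ratio j l l'" using assms(4-6) by simp
  then show False using z_mult_neq[OF ratio_closed[OF assms(1-3)]] by blast
qed

end

text \<open>The columns contributing the square of the first variable are those where both rows
  carry it, that is, the intersection of two of the triples.\<close>

lemma no_full_SOD_3_3: "\<not> full_SOD S z T 6 [3, 3] c e"
proof
  assume "full_SOD S z T 6 [3, 3] c e"
  then interpret full_SOD S z T 6 "[3, 3]" c e .
  have "{l. l < 6 \<and> {c i l, c j l} = {0, 0}} = {l. l < 6 \<and> c i l = 0} \<inter> {l. l < 6 \<and> c j l = 0}" for i j
    by auto
  then show False
    using even_columns[of _ _ 0 0] c_card[of _ 0]
    by (intro no_six_triples_even_intersections[of "\<lambda>i. {l. l < 6 \<and> c i l = 0}"]) auto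
qed

section \<open>Type (2, 2, 2)\<close>

lemma less_3_iff: "(a::nat) < 3 \<longleftrightarrow> a = 0 \<or> a = 1 \<or> a = 2"
  by auto

text \<open>Diagonal entries are 0 or 2. A diagonal 2 clears the rest of its row and column, and
  parity settles the remaining block. With zero diagonal the sums force
  \<open>n01 = n12 = n20\<close> and \<open>n02 = n10 = n21\<close>, with total 2 for the two
  values.\<close>

lemma doubly_stochastic_parity:
  fixes n00 n01 n02 n10 n11 n12 n20 n21 n22 :: nat
  assumes "n00 + n01 + n02 = 2" "n10 + n11 + n12 = 2" "n20 + n21 + n22 = 2"
    "n00 + n10 + n20 = 2" "n01 + n11 + n21 = 2" "n02 + n12 + n22 = 2"
    "even n00" "even n11" "even n22" "even (n01 + n10)" "even (n02 + n20)" "even (n12 + n21)"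
  shows "(n00 = 0 \<and> n11 = 0 \<and> n22 = 0 \<and> n01 = 1 \<and> n10 = 1 \<and> n02 = 1 \<and> n20 = 1 \<and> n12 = 1 \<and> n21 = 1) \<or>
   ((n00 = 0 \<or> n00 = 2) \<and> (n01 = 0 \<or> n01 = 2) \<and> (n02 = 0 \<or> n02 = 2) \<and>
    (n10 = 0 \<or> n10 = 2) \<and> (n11 = 0 \<or> n11 = 2) \<and> (n12 = 0 \<or> n12 = 2) \<and>
    (n20 = 0 \<or> n20 = 2) \<and> (n21 = 0 \<or> n21 = 2) \<and> (n22 = 0 \<or> n22 = 2))"
proof -
  have d: "n00 = 0 \<or> n00 = 2" "n11 = 0 \<or> n11 = 2" "n22 = 0 \<or> n22 = 2"
    using assms(1,7) assms(2,8) assms(3,9) by presburger+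
  have n: "n01 = 0 \<or> n01 = 1 \<or> n01 = 2" using assms(1) by presburger
  show ?thesis
    using d(1)
  proof
    assume "n00 = 2"
    then have "n01 = 0" "n02 = 0" "n10 = 0" "n20 = 0" using assms by auto
    then show ?thesis using d assms by auto
  next
    assume 0: "n00 = 0"
    show ?thesis using d(2)
    proof
      assume "n11 = 2"
      then have "n01 = 0" "n21 = 0" "n10 = 0" "n12 = 0" using assms by auto
      then show ?thesis using 0 d assms by auto
    next
      assume 1: "n11 = 0"
      show ?thesis using d(3)
      proof
        assume "n22 = 2"
        then have "n20 = 0" "n21 = 0" "n02 = 0" "n12 = 0" using assms by auto
        then show ?thesis using 0 1 d assms by auto
      next
        assume 2: "n22 = 0"
        have "n12 = n01" "n20 = n01" "n10 = n02" "n21 = n02" "n01 + n02 = 2"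
          using 0 1 2 assms(1-6) by linarith+
        then show ?thesis using 0 1 2 n by auto
      qed
    qed
  qed
qed

text \<open>Modulo 3, \<open>x1 + 2 * x0\<close> is the difference \<open>x1 - x0\<close>, which is
  1 for even and 2 for odd permutations of the colours. Equal values make the passage from
  \<open>x\<close> to \<open>y\<close> even, whereas exchanging two colours would make it a
  transposition.\<close>

lemma transposition_sign_mod_3:
  fixes x0 x1 x2 y0 y1 y2 :: nat
  assumes "x0 < 3" "x1 < 3" "x2 < 3" "x0 \<noteq> x1" "x0 \<noteq> x2" "x1 \<noteq> x2"
   "y0 < 3" "y1 < 3" "y2 < 3" "y0 \<noteq> y1" "y0 \<noteq> y2" "y1 \<noteq> y2"
   "(x1 + 2 * x0) mod 3 = (y1 + 2 * y0) mod 3"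
  shows "\<not> (x1 = y0 \<and> y1 = x0)" "\<not> (x2 = y0 \<and> y2 = x0)"
proof -
  show "\<not> (x1 = y0 \<and> y1 = x0)"
   using assms(1,2,4,13) unfolding less_3_iff by auto
  show "\<not> (x2 = y0 \<and> y2 = x0)"
  proof
    assume "x2 = y0 \<and> y2 = x0"
    moreover have "x1 = 3 - x0 - x2" "y1 = 3 - y0 - y2" using assms(1-12) by linarith+
    ultimately show False using assms(1,3,5,13) unfolding less_3_iff by auto
  qed
qed

lemma sign_mod_3:
  "(x0::nat) < 3 \<Longrightarrow> x1 < 3 \<Longrightarrow> x0 \<noteq> x1 \<Longrightarrow> (x1 + 2 * x0) mod 3 = 1 \<or> (x1 + 2 * x0) mod 3 = 2"
  unfolding less_3_iff by auto

section \<open>Aligned and mixed pairs of rows\<close>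

locale SOD_2_2_2 = full_SOD S z T 6 "[2, 2, 2]" c e for S (structure) and z T c e
begin

definition aligned :: "nat \<Rightarrow> nat \<Rightarrow> bool" where
  "aligned i j \<longleftrightarrow> (\<forall>l<6. \<forall>l'<6. c i l = c i l' \<longleftrightarrow> c j l = c j l')"

definition mixed :: "nat \<Rightarrow> nat \<Rightarrow> bool" where
  "mixed i j \<longleftrightarrow> (\<forall>l<6. c i l \<noteq> c j l) \<and>
     (\<forall>a<3. \<forall>b<3. a \<noteq> b \<longrightarrow> (\<exists>!l. l < 6 \<and> c i l = a \<and> c j l = b))"

lemma c_less_3: "i < 6 \<Longrightarrow> l < 6 \<Longrightarrow> c i l < 3"
  using c_less[of i l] by simp

lemma c_card_2: "i < 6 \<Longrightarrow> a < 3 \<Longrightarrow> card {l. l < 6 \<and> c i l = a} = 2"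
  using c_card[of i a] by (auto simp: less_3_iff)

text \<open>The sizes of the cells \<open>C a b\<close> form a 3 by 3 table with all line sums 2, to
  which \<open>doubly_stochastic_parity\<close> applies. Ones off the diagonal give
  \<open>mixed\<close>; entries 0 and 2 give \<open>aligned\<close>.\<close>

lemma aligned_or_mixed:
  assumes i: "i < 6" and j: "j < 6" and "i \<noteq> j"
  shows "aligned i j \<or> mixed i j"
proof -
  define C where "C a b = {l. l < 6 \<and> c i l = a \<and> c j l = b}" for a b
  have fin: "finite (C a b)" for a b by (simp add: C_def)
  have disj: "C a b \<inter> C a' b' = {}" if "a \<noteq> a' \<or> b \<noteq> b'" for a b a' b'
    using that by (auto simp: C_def)
  have row: "card (C a 0) + card (C a 1) + card (C a 2) = 2" if "a < 3" for a
  proof -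
    have "{l. l < 6 \<and> c i l = a} = (C a 0 \<union> C a 1) \<union> C a 2"
      using c_less_3[OF j] by (auto simp: C_def less_3_iff)
    moreover have "card \<dots> = card (C a 0) + card (C a 1) + card (C a 2)"
      by (simp add: card_Un_disjoint fin disj Int_Un_distrib2)
    ultimately show ?thesis using c_card_2[OF i that] by simp
  qed
  have col: "card (C 0 b) + card (C 1 b) + card (C 2 b) = 2" if "b < 3" for b
  proof -
    have "{l. l < 6 \<and> c j l = b} = (C 0 b \<union> C 1 b) \<union> C 2 b"
      using c_less_3[OF i] by (auto simp: C_def less_3_iff)
    moreover have "card \<dots> = card (C 0 b) + card (C 1 b) + card (C 2 b)"
      by (simp add: card_Un_disjoint fin disj Int_Un_distrib2)
    ultimately show ?thesis using c_card_2[OF j that] by simp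
  qed
  have diag: "even (card (C a a))" for a
  proof -
    have "{l. l < 6 \<and> {c i l, c j l} = {a, a}} = C a a" by (auto simp: C_def)
    then show ?thesis using even_columns[OF assms, of a a] by simp
  qed
  have off: "even (card (C a b) + card (C b a))" if "a \<noteq> b" for a b
  proof -
    have "{l. l < 6 \<and> {c i l, c j l} = {a, b}} = C a b \<union> C b a"
      by (auto simp: C_def doubleton_eq_iff)
    moreover have "card (C a b \<union> C b a) = card (C a b) + card (C b a)"
      using that by (intro card_Un_disjoint) (auto simp: C_def)
    ultimately show ?thesis using even_columns[OF assms, of a b] by simp
  qed
  have r: "card (C 0 0) + card (C 0 1) + card (C 0 2) = 2"
     "card (C 1 0) + card (C 1 1) + card (C 1 2) = 2"
     "card (C 2 0) + card (C 2 1) + card (C 2 2) = 2" by (rule row; simp)+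
  have k: "card (C 0 0) + card (C 1 0) + card (C 2 0) = 2"
     "card (C 0 1) + card (C 1 1) + card (C 2 1) = 2"
     "card (C 0 2) + card (C 1 2) + card (C 2 2) = 2" by (rule col; simp)+
  have "(\<forall>a<3. \<forall>b<3. card (C a b) = (if a = b then 0 else 1)) \<or>
      (\<forall>a<3. \<forall>b<3. card (C a b) = 0 \<or> card (C a b) = 2)"
    using doubly_stochastic_parity[OF r k diag diag diag off off off] by (auto simp: less_3_iff)
  then show ?thesis
  proof
    assume *: "\<forall>a<3. \<forall>b<3. card (C a b) = (if a = b then 0 else 1)"
    have "c i l \<noteq> c j l" if "l < 6" for l
    proof
      assume "c i l = c j l"
      then have "l \<in> C (c i l) (c i l)" using that by (simp add: C_def)
      moreover have "card (C (c i l) (c i l)) = 0" using * c_less_3[OF i that] by simp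
      then have "C (c i l) (c i l) = {}" by (simp add: fin)
      ultimately show False by blast
    qed
    moreover have "\<exists>!l. l < 6 \<and> c i l = a \<and> c j l = b" if "a < 3" "b < 3" "a \<noteq> b" for a b
    proof -
      have "card (C a b) = 1" using * that by simp
      then obtain l where "C a b = {l}" by (auto simp: card_1_singleton_iff)
      then have "(k < 6 \<and> c i k = a \<and> c j k = b) = (k = l)" for k
        unfolding C_def set_eq_iff by simp
      then show ?thesis by simp
    qed
    ultimately show ?thesis unfolding mixed_def by (intro disjI2 conjI allI impI)
  next
    assume *: "\<forall>a<3. \<forall>b<3. card (C a b) = 0 \<or> card (C a b) = 2"
    \<comment> \<open>A nonempty cell has two columns, hence exhausts a colour class of each
      row.\<close>
    have full: "C (c i l) (c j l) = {k. k < 6 \<and> c i k = c i l}"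
      "C (c i l) (c j l) = {k. k < 6 \<and> c j k = c j l}" if l: "l < 6" for l
    proof -
      have "card (C (c i l) (c j l)) \<noteq> 0" using l fin by (auto simp: C_def)
      then have "card (C (c i l) (c j l)) = 2" 
        using *[rule_format, OF c_less_3[OF i l] c_less_3[OF j l]] by simp
      moreover have "C (c i l) (c j l) \<subseteq> {k. k < 6 \<and> c i k = c i l}"
        "C (c i l) (c j l) \<subseteq> {k. k < 6 \<and> c j k = c j l}" by (auto simp: C_def)
      moreover have "card {k. k < 6 \<and> c i k = c i l} = 2" "card {k. k < 6 \<and> c j k = c j l} = 2"
        by (intro c_card_2 c_less_3 i j l)+
      ultimately show "C (c i l) (c j l) = {k. k < 6 \<and> c i k = c i l}"
        "C (c i l) (c j l) = {k. k < 6 \<and> c j k = c j l}"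
        by (simp_all add: card_subset_eq)
    qed
    have "aligned i j" unfolding aligned_def
    proof (intro allI impI iffI)
      fix l l' :: nat assume l: "l < 6" "l' < 6"
      { assume "c i l = c i l'"
        then have "l' \<in> C (c i l) (c j l)" using full(1)[OF l(1)] l by simp
        then show "c j l = c j l'" by (simp add: C_def) }
      { assume "c j l = c j l'"
        then have "l' \<in> C (c i l) (c j l)" using full(2)[OF l(1)] l by simp
        then show "c i l = c i l'" by (simp add: C_def) }
    qed
    then show ?thesis ..
  qed
qed

lemma mixed_irrefl: "\<not> mixed i i"
proof
  assume "mixed i i"
  then have "c i 0 \<noteq> c i 0" unfolding mixed_def by (metis zero_less_numeral)
  then show False by simp
qed

lemma mixed_cong:
  assumes m: "mixed i j" and eq: "\<And>l. l < 6 \<Longrightarrow> c x l = c i l"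
  shows "mixed x j"
proof -
  have *: "(l < 6 \<and> c x l = a \<and> c j l = b) = (l < 6 \<and> c i l = a \<and> c j l = b)" for l a b
    using eq by auto
  have "\<forall>l<6. c x l \<noteq> c j l" using m eq by (simp add: mixed_def)
  then show ?thesis using m unfolding mixed_def * by blast
qed

text \<open>In a mixed pair each product of two distinct variables comes from exactly two columns,
  one for each order of the colours.\<close>

lemma mixed_opposite:
  assumes m: "mixed i j" and ij: "i < 6" "j < 6" "i \<noteq> j" and l: "l < 6" "l' < 6"
    and swap: "c i l' = c j l" "c j l' = c i l"
  shows "ratio i l l' = z \<otimes> ratio j l l'"
proof -
  have ne: "c i l \<noteq> c j l" using m l(1) by (simp add: mixed_def)
  have u: "\<exists>!k. k < 6 \<and> c i k = a \<and> c j k = b" if "a < 3" "b < 3" "a \<noteq> b" for a b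
    using m that unfolding mixed_def by blast
  have "\<exists>!k. k < 6 \<and> c i k = c i l \<and> c j k = c j l" "\<exists>!k. k < 6 \<and> c i k = c j l \<and> c j k = c i l"
    by (rule u; use ne c_less_3 ij l in simp)+
  then have "{k. k < 6 \<and> {c i k, c j k} = {c i l, c j l}} = {l, l'}"
    using l swap by (auto simp: doubleton_eq_iff)
  then show ?thesis using ne swap l ij by (intro ratio_opposite) auto
qed

text \<open>For aligned rows, the monomial of a block could occur elsewhere only on a block with the
  two colours exchanged. The hypothesis \<open>noswap\<close> excludes this, while still allowing
  both rows to have the same colour on the block.\<close>

lemma block_opposite:
  assumes al: "aligned i j" and ij: "i < 6" "j < 6" "i \<noteq> j" and l: "l < 6" "l' < 6" "l \<noteq> l'"
    and eq: "c i l = c i l'"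
    and noswap: "\<And>k. k < 6 \<Longrightarrow> c i k = c j l \<Longrightarrow> c j k = c i l \<Longrightarrow> c i k = c i l"
  shows "ratio i l l' = z \<otimes> ratio j l l'"
proof -
  have "{l, l'} = {k. k < 6 \<and> c i k = c i l}"
    using c_card_2[OF ij(1) c_less_3[OF ij(1) l(1)]] l eq by (intro card_subset_eq) auto
  moreover have "{k. k < 6 \<and> {c i k, c j k} = {c i l, c j l}} = {k. k < 6 \<and> c i k = c i l}"
    using noswap al l(1) by (auto simp: doubleton_eq_iff aligned_def)
  ultimately show ?thesis using l ij by (intro ratio_opposite) auto
qed

lemma obtain_block:
  assumes "i < 6" "a < 3"
  obtains l l' where "l < 6" "l' < 6" "l \<noteq> l'" "c i l = a" "c i l' = a"
proof -
  obtain l l' where *: "{l. l < 6 \<and> c i l = a} = {l, l'}" "l \<noteq> l'"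
    using c_card_2[OF assms] by (auto simp: card_2_iff)
  have "l \<in> {l. l < 6 \<and> c i l = a}" "l' \<in> {l. l < 6 \<and> c i l = a}" by (simp_all add: *(1))
  then show ?thesis using that *(2) by blast
qed

lemma equal_colouring_opposite:
  assumes ij: "i < 6" "j < 6" "i \<noteq> j" and eq: "\<And>l. l < 6 \<Longrightarrow> c i l = c j l"
    and l: "l < 6" "l' < 6" "l \<noteq> l'" "c i l = c i l'"
  shows "ratio i l l' = z \<otimes> ratio j l l'"
  using eq l by (intro block_opposite[OF _ ij]) (auto simp: aligned_def)

text \<open>Three equally coloured rows would have pairwise opposite quotients on a common
  block.\<close>

lemma equal_colouring_card:
  "card {i. i < 6 \<and> (\<forall>l<6. c i l = f l)} \<le> 2"
proof (rule ccontr)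
  assume "\<not> ?thesis"
  then have "3 \<le> card {i. i < 6 \<and> (\<forall>l<6. c i l = f l)}" by simp
  then obtain i j k where ijk: "i < 6" "j < 6" "k < 6" "i \<noteq> j" "i \<noteq> k" "j \<noteq> k"
    and f: "\<And>l. l < 6 \<Longrightarrow> c i l = f l" "\<And>l. l < 6 \<Longrightarrow> c j l = f l" "\<And>l. l < 6 \<Longrightarrow> c k l = f l"
    by (rule card_ge_3_obtain) auto
  obtain l l' where l: "l < 6" "l' < 6" "l \<noteq> l'" "c i l = 0" "c i l' = 0"
    using obtain_block[OF ijk(1), of 0] by auto
  have "ratio x l l' = z \<otimes> ratio y l l'" if "x \<in> {i, j, k}" "y \<in> {i, j, k}" "x \<noteq> y" for x y
    using that ijk f l by (intro equal_colouring_opposite) auto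
  then show False using no_three_opposite[OF ijk(2) l(1,2), of i k] ijk by blast
qed

lemma mixed_third_row:
  assumes m: "mixed i j" and i: "i < 6" and j: "j < 6" and k: "k < 6" "k \<noteq> i" "k \<noteq> j"
  shows "(\<forall>l<6. c k l = c i l) \<or> (\<forall>l<6. c k l = c j l) \<or> mixed i k \<and> mixed j k"
proof -
  \<comment> \<open>On a block of \<open>x\<close>, row \<open>y\<close> shows both of the other
    colours. Row \<open>k\<close> is constant there and must avoid both, so it copies
    \<open>x\<close>.\<close>
  have step: "\<forall>l<6. c k l = c x l"
    if x: "x < 6" "y < 6" and xy: "mixed x y" and al: "aligned x k" and yk: "mixed y k" for x y
  proof (intro allI impI)
    fix l :: nat assume l: "l < 6"
    obtain b where b: "b < 3" "b \<noteq> c x l" "b \<noteq> c y l"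
      by (metis less_3_iff one_eq_numeral_iff zero_neq_numeral zero_neq_one numeral_eq_iff semiring_norm(85))
    obtain l' where l': "l' < 6" "c x l' = c x l" "c y l' = b"
      using xy b c_less_3[OF x(1) l] unfolding mixed_def by metis
    have "c k l' = c k l" using al l l' unfolding aligned_def by metis
    then have "c k l \<noteq> b" "c k l \<noteq> c y l" using yk l l' unfolding mixed_def by metis+
    moreover have "c x l \<noteq> c y l" using xy l by (simp add: mixed_def)
    ultimately show "c k l = c x l"
      using b c_less_3[OF x(1) l] c_less_3[OF x(2) l] c_less_3[OF k(1) l] by linarith
  qed
  have m': "mixed j i" using m unfolding mixed_def by metis
  have "\<not> (aligned i k \<and> aligned j k)"
  proof
    assume *: "aligned i k \<and> aligned j k"
    obtain l l' where "l < 6" "c i l = 0" "c j l = 1" "l' < 6" "c i l' = 0" "c j l' = 2"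
      using m unfolding mixed_def by (metis less_3_iff zero_neq_numeral zero_neq_one)
    then show False using * unfolding aligned_def by (metis one_eq_numeral_iff semiring_norm(85))
  qed
  then show ?thesis
    using step[OF i j m] step[OF j i m'] aligned_or_mixed[OF i k(1)] aligned_or_mixed[OF j k(1)] k(2,3)
    by metis
qed

section \<open>Excluding mixed pairs\<close>

lemma not_mixed:
  assumes i: "i < 6" and j: "j < 6"
  shows "\<not> mixed i j"
proof
  assume m: "mixed i j"
  define M where "M = {k. k < 6 \<and> (\<forall>l<6. c k l = c i l)}"
  define N where "N = {k. k < 6 \<and> (\<forall>l<6. c k l = c j l)}"
  define K where "K = {k. k < 6 \<and> mixed i k \<and> mixed j k}"
  \<comment> \<open>The colours 0, 1, 2 sum to 3, so this is the colour missing from rows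
    \<open>i\<close> and \<open>j\<close>; all rows in \<open>K\<close> are thus coloured
    alike.\<close>
  have third: "c k l = 3 - c i l - c j l" if "k \<in> K" "l < 6" for k l
  proof -
    have "c k l < 3" "c i l < 3" "c j l < 3" "c i l \<noteq> c k l" "c j l \<noteq> c k l" "c i l \<noteq> c j l"
      using c_less_3 i j m that by (auto simp: K_def mixed_def)
    then show ?thesis by (auto simp: less_3_iff)
  qed
  have "k \<in> M \<union> N \<union> K" if "k < 6" for k
    using mixed_third_row[OF m i j that] that by (auto simp: M_def N_def K_def)
  then have "{..<6} \<subseteq> M \<union> N \<union> K" by auto
  then have "card {..<6::nat} \<le> card (M \<union> N \<union> K)"
    by (rule card_mono[rotated]) (simp add: M_def N_def K_def)
  then have "6 \<le> card M + card N + card K"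
    using card_Un_le[of "M \<union> N" K] card_Un_le[of M N] by simp
  moreover have "card M \<le> 2" "card N \<le> 2" unfolding M_def N_def by (rule equal_colouring_card)+
  moreover have "card K \<le> 2"
  proof -
    have "K \<subseteq> {k. k < 6 \<and> (\<forall>l<6. c k l = 3 - c i l - c j l)}"
      using third by (auto simp: K_def)
    then have "card K \<le> card {k. k < 6 \<and> (\<forall>l<6. c k l = 3 - c i l - c j l)}"
      by (rule card_mono[rotated]) simp
    then show ?thesis using equal_colouring_card[of "\<lambda>l. 3 - c i l - c j l"] by simp
  qed
  ultimately have "card M = 2" "card K \<noteq> 0" by linarith+
  then obtain i1 i2 k where i12: "i1 \<in> M" "i2 \<in> M" "i1 \<noteq> i2" and k: "k \<in> K"
    by (metis all_not_in_conv card.empty card_2_iff insertCI)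
  have rows: "i1 < 6" "i2 < 6" "k < 6" using i12 k by (auto simp: M_def K_def)
  have col: "c x l = c i l" if "x = i1 \<or> x = i2" "l < 6" for x l
    using i12 that by (auto simp: M_def)
  have mx: "mixed x j" "mixed x k" "x \<noteq> j" "x \<noteq> k" if x: "x = i1 \<or> x = i2" for x
  proof -
    show *: "mixed x j" "mixed x k"
      using m k col[OF x] by (auto intro: mixed_cong simp: K_def)
    show "x \<noteq> j" "x \<noteq> k" using * mixed_irrefl by auto
  qed
  have ex: "\<exists>l. l < 6 \<and> c i l = a \<and> c j l = b" if "a < 3" "b < 3" "a \<noteq> b" for a b
    using m that unfolding mixed_def by (meson ex1_implies_ex)
  \<comment> \<open>The digits are the colours of the column in rows \<open>i\<close> and
    \<open>j\<close>; row \<open>k\<close> has the remaining one.\<close>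
  obtain l01 l02 l12 l21 where
    l01: "l01 < 6" "c i l01 = 0" "c j l01 = 1" and l02: "l02 < 6" "c i l02 = 0" "c j l02 = 2"
    and l12: "l12 < 6" "c i l12 = 1" "c j l12 = 2" and l21: "l21 < 6" "c i l21 = 2" "c j l21 = 1"
    using ex[of 0 1] ex[of 0 2] ex[of 1 2] ex[of 2 1] by auto
  \<comment> \<open>Along each edge two rows exchange their colours: \<open>x\<close> and
    \<open>k\<close> exchange 0 and 2, then \<open>x\<close> and \<open>j\<close> exchange 2 and 1,
    then \<open>x\<close> and \<open>k\<close> exchange 1 and 0.\<close>
  have r: "ratio x l01 l21 = z \<otimes> ratio k l01 l21" "ratio x l21 l12 = z \<otimes> ratio j l21 l12"
    "ratio x l12 l02 = z \<otimes> ratio k l12 l02" if x: "x = i1 \<or> x = i2" for x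
    using rows j mx[OF x] x col[OF x] third[OF k] l01 l02 l12 l21 by (intro mixed_opposite; auto)+
  \<comment> \<open>The path \<open>l01, l21, l12, l02\<close> avoids the blocks of row \<open>i\<close>, and along each of its edges both
    \<open>i1\<close> and \<open>i2\<close> are opposite to one common row.\<close>
  have "ratio i1 l01 l02 = ratio i2 l01 l02"
    using r rows l01 l02 l12 l21 by (simp add: ratio_trans[of _ l01 l21 l02] ratio_trans[of _ l21 l12 l02])
  moreover have "ratio i1 l01 l02 = z \<otimes> ratio i2 l01 l02"
    using col rows i12(3) l01 l02 by (intro equal_colouring_opposite) auto
  ultimately show False using z_mult_neq ratio_closed rows l01 l02 by metis
qed

section \<open>Excluding six pairwise aligned rows\<close>

lemma impossible: False
proof -
  have al: "aligned i j" if "i < 6" "j < 6" for i j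
    using aligned_or_mixed[OF that] not_mixed[OF that] by (cases "i = j") (auto simp: aligned_def)
  obtain p0 p' where p0: "p0 < 6" "p' < 6" "p0 \<noteq> p'" "c 0 p0 = 0" "c 0 p' = 0"
    using obtain_block[of 0 0] by auto
  obtain p1 where p1: "p1 < 6" "c 0 p1 = 1" using obtain_block[of 0 1] by auto
  obtain p2 where p2: "p2 < 6" "c 0 p2 = 2" using obtain_block[of 0 2] by auto
  have vals: "c i p0 < 3" "c i p1 < 3" "c i p2 < 3" "c i p0 \<noteq> c i p1" "c i p0 \<noteq> c i p2" "c i p1 \<noteq> c i p2"
    "c i p' = c i p0" if "i < 6" for i
    using al[of 0 i] c_less_3[OF that] that p0 p1 p2 unfolding aligned_def by (metis zero_less_numeral zero_neq_one zero_neq_numeral one_eq_numeral_iff semiring_norm(85))+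
  \<comment> \<open>The columns \<open>p0\<close>, \<open>p1\<close>, \<open>p2\<close> represent
    the three blocks shared by all rows, so every column is coloured like one of them in both rows
    at once.\<close>
  have cover: "c i l = c i p0 \<and> c j l = c j p0 \<or> c i l = c i p1 \<and> c j l = c j p1 \<or> c i l = c i p2 \<and> c j l = c j p2"
    if "i < 6" "j < 6" "l < 6" for i j l
  proof -
    have "c 0 l = 0 \<or> c 0 l = 1 \<or> c 0 l = 2" using c_less_3[of 0 l] that by auto
    then show ?thesis using al[of 0 i] al[of 0 j] that p0 p1 p2 unfolding aligned_def
      by (metis zero_less_numeral)
  qed
  \<comment> \<open>Colour differences modulo 3 detect the sign of the permutation that carries row 0 to row \<open>i\<close>.\<close>
  define sign where "sign i = (c i p1 + 2 * c i p0) mod 3" for i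
  have opp: "ratio i p0 p' = z \<otimes> ratio j p0 p'"
    if ij: "i < 6" "j < 6" "i \<noteq> j" and s: "sign i = sign j" for i j
  proof (rule block_opposite[OF al[OF ij(1,2)] ij p0(1-3)])
    show "c i p0 = c i p'" using vals[OF ij(1)] by simp
    show "c i k = c i p0" if "k < 6" "c i k = c j p0" "c j k = c i p0" for k
      using cover[OF ij(1,2) that(1)] that(2,3)
        transposition_sign_mod_3[OF vals(1-6)[OF ij(1)] vals(1-6)[OF ij(2)] s[unfolded sign_def]]
      by auto
  qed
  have "sign i = 1 \<or> sign i = 2" if "i < 6" for i
    unfolding sign_def by (rule sign_mod_3) (use vals[OF that] in auto)
  \<comment> \<open>Pigeonhole: six rows and two signs give three rows of the same sign.\<close>
  then have "{..<6} \<subseteq> {i. i < 6 \<and> sign i = 1} \<union> {i. i < 6 \<and> sign i = 2}" by auto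
  then have "card {..<6::nat} \<le> card ({i. i < 6 \<and> sign i = 1} \<union> {i. i < 6 \<and> sign i = 2})"
    by (intro card_mono) auto
  also have "\<dots> \<le> card {i. i < 6 \<and> sign i = 1} + card {i. i < 6 \<and> sign i = 2}" by (rule card_Un_le)
  finally have "3 \<le> card {i. i < 6 \<and> sign i = 1} \<or> 3 \<le> card {i. i < 6 \<and> sign i = 2}"
    unfolding card_lessThan by linarith
  then obtain s where "3 \<le> card {i. i < 6 \<and> sign i = s}" by blast
  then obtain i j k where ijk: "i < 6" "j < 6" "k < 6" "i \<noteq> j" "i \<noteq> k" "j \<noteq> k"
    and s: "sign i = s" "sign j = s" "sign k = s" by (rule card_ge_3_obtain) auto
  show False
    by (rule no_three_opposite[where k = k, OF ijk(2) p0(1,2) opp opp opp]) (use ijk s in simp_all)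
qed

end

theorem theorem7:
  fixes S :: "('a, 'b) monoid_scheme" and z :: 'a and T :: "'a set"
  assumes "signed_group S z"
    and "transversal S (generate S {z}) T"
  shows "(\<nexists>A. is_SOD S z T 6 [3, 3] A) \<and> (\<nexists>A. is_SOD S z T 6 [2, 2, 2] A)"
proof -
  interpret signed_group_transversal S z T
    using assms by (intro signed_group_transversal.intro signed_group_transversal_axioms.intro)
  have "\<not> is_SOD S z T 6 [3, 3] A" for A
    by (rule notI, erule full_SOD_of_SOD) (simp_all add: no_full_SOD_3_3)
  moreover have "\<not> is_SOD S z T 6 [2, 2, 2] A" for A
    by (rule notI, erule full_SOD_of_SOD)
      (auto simp: SOD_2_2_2_def[symmetric] dest: SOD_2_2_2.impossible)
  ultimately show ?thesis by blast
qed

end
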